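(* Let $M$ be an object of PreCu, and let $\overline{M}=\Lambda_\sigma(M)/\!\sim$ be the monoid of equivalence classes of countably generated intervals in $M$. Then $\overline{M}$ is an object of Cu, the map $\iota\colon M\to\overline{M}$, $\iota(x)=[I(x)]$, where $I(x)=[0,x]=\{y\in M\mid y\le x\}$, is an order-embedding in PreCu, and $(\overline{M},\iota)$ is the completion of $M$.
   Context: All monoids are commutative, written additively with neutral element $0$, and equipped with a partial order $\le$ compatible with addition such that $x\ge 0$ for every element $x$. Maps between monoids are additive, order-preserving and preserve $0$. A monoid map $\varphi\colon M\to N$ is an order-embedding if $a\le b$ whenever $\varphi(a)\le\varphi(b)$. The supremum of an increasing sequence is its least upper bound, if it exists. For $x,y$ in a monoid $M$, write $x\ll y$ if, whenever $(y_n)$ is an increasing sequence in $M$ whose supremum exists in $M$ and $y\le\sup y_n$, then $x\le y_k$ for some $k$. A sequence $(x_n)$ is rapidly increasing if $x_n\ll x_{n+1}$ for all $n$. PreCu is the category whose objects are the monoids $M$ (commutative, written additively with neutral element $0$, and equipped with a partial order $\le$ compatible with addition such that $x\ge 0$ for every $x\in M$) such that (i) every element of $M$ is the supremum of a rapidly increasing sequence in $M$; (ii) $\ll$ and suprema are compatible with addition: $x\ll y$ and $z\ll t$ imply $x+z\ll y+t$, and if $(x_n)$, $(y_n)$ are increasing sequences with suprema $x$, $y$, then $x+y$ is the supremum of $(x_n+y_n)$. Maps in PreCu are monoid maps that preserve suprema of increasing sequences (when they exist) and preserve $\ll$. Cu is the full subcategory of PreCu consisting of the objects in which every increasing sequence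 has a supremum. A completion of an object $M$ of PreCu is a pair $(N,\iota)$ such that (i) $N$ is an object of Cu; (ii) $\iota\colon M\to N$ is an order-embedding and a map in PreCu; (iii) for every $x\in N$ there is a rapidly increasing sequence $(x_n)$ in $M$ such that $x=\sup\iota(x_n)$. A completion, when it exists, is unique up to order-isomorphism. An interval in $M$ is a nonempty, upward directed, order-hereditary subset $I\subseteq M$ (if $x\le y\in I$ then $x\in I$). Intervals are added by $I+J=\{z\in M\mid z\le x+y\text{ for some }x\in I,\ y\in J\}$. An interval is countably generated if it has a countable cofinal subset, equivalently if $I=\{x\in M\mid x\le x_n\text{ for some }n\}$ for some increasing sequence $(x_n)$ in $M$; $\Lambda_\sigma(M)$ is the monoid of countably generated intervals. For $I,J\in\Lambda_\sigma(M)$ write $I\precsim J$ if for every $x\in I$ and every $z\ll x$ there exists $y\in J$ with $z\ll y$; write $I\sim J$ if $I\precsim J$ and $J\precsim I$. The class of $I$ is denoted $[I]$, and $\overline{M}=\Lambda_\sigma(M)/\!\sim$ carries the order $[I]\le[J]\iff I\precsim J$ and the addition $[I]+[J]=[I+J]$. *)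

theory Defs
  imports "HOL-Algebra.Group" "HOL-Library.Countable_Set"
begin

section \<open>Positively ordered commutative monoids\<close>

record 'a ordered_monoid = "'a gorder" +
  oadd :: "['a, 'a] \<Rightarrow> 'a" (infixl \<open>\<oplus>\<index>\<close> 65)
  ozero :: 'a (\<open>\<zero>\<index>\<close>)

definition omonoid :: "('a, 'm) ordered_monoid_scheme \<Rightarrow> 'a monoid"
  where "omonoid M = \<lparr>carrier = carrier M, mult = oadd M, one = ozero M\<rparr>"

text \<open>The locale \<^locale>\<open>partial_order\<close> forces the field \<^const>\<open>eq\<close> to be HOL equality.\<close>

locale ordered_monoid = partial_order M + omon: comm_monoid "omonoid M" for M (structure) +
  assumes add_mono:
      "\<lbrakk>x \<in> carrier M; y \<in> carrier M; z \<in> carrier M; x \<sqsubseteq> y\<rbrakk> \<Longrightarrow> x \<oplus> z \<sqsubseteq> y \<oplus> z"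
    and zero_least: "x \<in> carrier M \<Longrightarrow> \<zero> \<sqsubseteq> x"

definition monoid_map ::
  "('a, 'm) ordered_monoid_scheme \<Rightarrow> ('b, 'n) ordered_monoid_scheme \<Rightarrow> ('a \<Rightarrow> 'b) \<Rightarrow> bool"
  where "monoid_map M N f \<longleftrightarrow>
    f \<in> hom (omonoid M) (omonoid N) \<and> f \<zero>\<^bsub>M\<^esub> = \<zero>\<^bsub>N\<^esub> \<and>
    (\<forall>x\<in>carrier M. \<forall>y\<in>carrier M. x \<sqsubseteq>\<^bsub>M\<^esub> y \<longrightarrow> f x \<sqsubseteq>\<^bsub>N\<^esub> f y)"

definition order_embedding ::
  "('a, 'm) ordered_monoid_scheme \<Rightarrow> ('b, 'n) ordered_monoid_scheme \<Rightarrow> ('a \<Rightarrow> 'b) \<Rightarrow> bool"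
  where "order_embedding M N f \<longleftrightarrow>
    monoid_map M N f \<and>
    (\<forall>x\<in>carrier M. \<forall>y\<in>carrier M. f x \<sqsubseteq>\<^bsub>N\<^esub> f y \<longrightarrow> x \<sqsubseteq>\<^bsub>M\<^esub> y)"


section \<open>The categories PreCu and Cu\<close>

definition increasing :: "('a, 'm) ordered_monoid_scheme \<Rightarrow> (nat \<Rightarrow> 'a) \<Rightarrow> bool"
  where "increasing M X \<longleftrightarrow> (\<forall>n. X n \<in> carrier M) \<and> (\<forall>n. X n \<sqsubseteq>\<^bsub>M\<^esub> X (Suc n))"

definition is_sup :: "('a, 'm) ordered_monoid_scheme \<Rightarrow> (nat \<Rightarrow> 'a) \<Rightarrow> 'a \<Rightarrow> bool"
  where "is_sup M X s \<longleftrightarrow> is_lub M s (range X)"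

definition way_below :: "('a, 'm) ordered_monoid_scheme \<Rightarrow> 'a \<Rightarrow> 'a \<Rightarrow> bool"
    (\<open>(_ \<lless>\<index> _)\<close> [51, 51] 50)
  where "x \<lless>\<^bsub>M\<^esub> y \<longleftrightarrow>
    x \<in> carrier M \<and> y \<in> carrier M \<and>
    (\<forall>Y s. increasing M Y \<and> is_sup M Y s \<and> y \<sqsubseteq>\<^bsub>M\<^esub> s \<longrightarrow> (\<exists>k. x \<sqsubseteq>\<^bsub>M\<^esub> Y k))"

definition rapidly_increasing :: "('a, 'm) ordered_monoid_scheme \<Rightarrow> (nat \<Rightarrow> 'a) \<Rightarrow> bool"
  where "rapidly_increasing M X \<longleftrightarrow> (\<forall>n. X n \<lless>\<^bsub>M\<^esub> X (Suc n))"

locale precu = ordered_monoid M for M (structure) +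
  assumes sup_of_rapidly_increasing:
      "x \<in> carrier M \<Longrightarrow> \<exists>X. rapidly_increasing M X \<and> is_sup M X x"
    and way_below_add: "\<lbrakk>x \<lless> y; z \<lless> t\<rbrakk> \<Longrightarrow> x \<oplus> z \<lless> y \<oplus> t"
    and sup_add:
      "\<lbrakk>increasing M X; increasing M Y; is_sup M X x; is_sup M Y y\<rbrakk>
        \<Longrightarrow> is_sup M (\<lambda>n. X n \<oplus> Y n) (x \<oplus> y)"

locale cu = precu M for M (structure) +
  assumes sup_exists: "increasing M X \<Longrightarrow> \<exists>s. is_sup M X s"

definition precu_map ::
  "('a, 'm) ordered_monoid_scheme \<Rightarrow> ('b, 'n) ordered_monoid_scheme \<Rightarrow> ('a \<Rightarrow> 'b) \<Rightarrow> bool"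
  where "precu_map M N f \<longleftrightarrow>
    monoid_map M N f \<and>
    (\<forall>X s. increasing M X \<and> is_sup M X s \<longrightarrow> is_sup N (\<lambda>n. f (X n)) (f s)) \<and>
    (\<forall>x y. x \<lless>\<^bsub>M\<^esub> y \<longrightarrow> f x \<lless>\<^bsub>N\<^esub> f y)"

definition completion ::
  "('a, 'm) ordered_monoid_scheme \<Rightarrow> ('b, 'n) ordered_monoid_scheme \<Rightarrow> ('a \<Rightarrow> 'b) \<Rightarrow> bool"
  where "completion M N f \<longleftrightarrow>
    precu M \<and> cu N \<and> order_embedding M N f \<and> precu_map M N f \<and>
    (\<forall>x\<in>carrier N. \<exists>X. rapidly_increasing M X \<and> is_sup N (\<lambda>n. f (X n)) x)"


section \<open>Countably generated intervals\<close>

definition interval :: "('a, 'm) ordered_monoid_scheme \<Rightarrow> 'a set \<Rightarrow> bool"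
  where "interval M I \<longleftrightarrow>
    I \<subseteq> carrier M \<and> I \<noteq> {} \<and>
    (\<forall>x\<in>I. \<forall>y\<in>I. \<exists>z\<in>I. x \<sqsubseteq>\<^bsub>M\<^esub> z \<and> y \<sqsubseteq>\<^bsub>M\<^esub> z) \<and>
    (\<forall>y\<in>I. \<forall>x\<in>carrier M. x \<sqsubseteq>\<^bsub>M\<^esub> y \<longrightarrow> x \<in> I)"

definition countably_generated :: "('a, 'm) ordered_monoid_scheme \<Rightarrow> 'a set \<Rightarrow> bool"
  where "countably_generated M I \<longleftrightarrow>
    (\<exists>C\<subseteq>I. countable C \<and> (\<forall>x\<in>I. \<exists>c\<in>C. x \<sqsubseteq>\<^bsub>M\<^esub> c))"

definition Lambda_sigma :: "('a, 'm) ordered_monoid_scheme \<Rightarrow> 'a set set"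
  where "Lambda_sigma M = {I. interval M I \<and> countably_generated M I}"

definition interval_add :: "('a, 'm) ordered_monoid_scheme \<Rightarrow> 'a set \<Rightarrow> 'a set \<Rightarrow> 'a set"
  where "interval_add M I J =
    {z \<in> carrier M. \<exists>x\<in>I. \<exists>y\<in>J. z \<sqsubseteq>\<^bsub>M\<^esub> x \<oplus>\<^bsub>M\<^esub> y}"

definition interval_le :: "('a, 'm) ordered_monoid_scheme \<Rightarrow> 'a set \<Rightarrow> 'a set \<Rightarrow> bool"
  where "interval_le M I J \<longleftrightarrow> (\<forall>x\<in>I. \<forall>z. z \<lless>\<^bsub>M\<^esub> x \<longrightarrow> (\<exists>y\<in>J. z \<lless>\<^bsub>M\<^esub> y))"

definition sim_rel :: "('a, 'm) ordered_monoid_scheme \<Rightarrow> ('a set \<times> 'a set) set"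
  where "sim_rel M =
    {(I, J) \<in> Lambda_sigma M \<times> Lambda_sigma M. interval_le M I J \<and> interval_le M J I}"

definition sim_class :: "('a, 'm) ordered_monoid_scheme \<Rightarrow> 'a set \<Rightarrow> 'a set set"
  where "sim_class M I = sim_rel M `` {I}"

definition principal_interval :: "('a, 'm) ordered_monoid_scheme \<Rightarrow> 'a \<Rightarrow> 'a set"
  where "principal_interval M x = {y \<in> carrier M. y \<sqsubseteq>\<^bsub>M\<^esub> x}"

text \<open>
  Order and addition of the quotient are given through representatives; the lemmas
  \<open>Mbar_le_class\<close> and \<open>Mbar_add_class\<close> below show that they do not depend on the choice.
\<close>

definition Mbar :: "('a, 'm) ordered_monoid_scheme \<Rightarrow> 'a set set ordered_monoid"
  where "Mbar M =
    \<lparr>carrier = Lambda_sigma M // sim_rel M,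
     eq = (=),
     le = (\<lambda>A B. \<exists>I\<in>A. \<exists>J\<in>B. interval_le M I J),
     oadd = (\<lambda>A B. \<Union>I\<in>A. \<Union>J\<in>B. sim_class M (interval_add M I J)),
     ozero = sim_class M (principal_interval M \<zero>\<^bsub>M\<^esub>)\<rparr>"

definition iota :: "('a, 'm) ordered_monoid_scheme \<Rightarrow> 'a \<Rightarrow> 'a set set"
  where "iota M x = sim_class M (principal_interval M x)"

lemma interval_le_refl: "interval_le M I I"
  by (auto simp: interval_le_def)

lemma interval_le_trans:
  "\<lbrakk>interval_le M I J; interval_le M J K\<rbrakk> \<Longrightarrow> interval_le M I K"
  unfolding interval_le_def by blast

lemma equiv_sim_rel: "equiv (Lambda_sigma M) (sim_rel M)"
  by (rule equivI)
    (auto simp: sim_rel_def refl_on_def sym_def trans_def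
      intro: interval_le_refl interval_le_trans)

lemma Mbar_carrier: "carrier (Mbar M) = sim_class M ` Lambda_sigma M"
  by (auto simp: Mbar_def sim_class_def quotient_def)

lemma sim_class_eq_iff:
  assumes "I \<in> Lambda_sigma M" "J \<in> Lambda_sigma M"
  shows "sim_class M I = sim_class M J \<longleftrightarrow> interval_le M I J \<and> interval_le M J I"
  using eq_equiv_class_iff[OF equiv_sim_rel assms] assms
  by (simp add: sim_class_def sim_rel_def)

lemma Mbar_le_class:
  assumes "I \<in> Lambda_sigma M" "J \<in> Lambda_sigma M"
  shows "sim_class M I \<sqsubseteq>\<^bsub>Mbar M\<^esub> sim_class M J \<longleftrightarrow> interval_le M I J"
proof
  assume "sim_class M I \<sqsubseteq>\<^bsub>Mbar M\<^esub> sim_class M J"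
  then obtain I' J' where "interval_le M I I'" "interval_le M I' J'" "interval_le M J' J"
    by (auto simp: Mbar_def sim_class_def sim_rel_def)
  then show "interval_le M I J" using interval_le_trans by metis
next
  assume "interval_le M I J"
  moreover have "I \<in> sim_class M I" "J \<in> sim_class M J"
    using assms by (auto simp: sim_class_def sim_rel_def interval_le_refl)
  ultimately show "sim_class M I \<sqsubseteq>\<^bsub>Mbar M\<^esub> sim_class M J"
    by (auto simp: Mbar_def)
qed

context ordered_monoid
begin

lemma add_closed: "\<lbrakk>x \<in> carrier M; y \<in> carrier M\<rbrakk> \<Longrightarrow> x \<oplus> y \<in> carrier M"
  using omon.m_closed by (simp add: omonoid_def)

lemma add_comm: "\<lbrakk>x \<in> carrier M; y \<in> carrier M\<rbrakk> \<Longrightarrow> x \<oplus> y = y \<oplus> x"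
  using omon.m_comm by (simp add: omonoid_def)

lemma add_mono2:
  assumes "x \<in> carrier M" "x' \<in> carrier M" "y \<in> carrier M" "y' \<in> carrier M" "x \<sqsubseteq> x'" "y \<sqsubseteq> y'"
  shows "x \<oplus> y \<sqsubseteq> x' \<oplus> y'"
proof -
  have 1: "x \<oplus> y \<sqsubseteq> x' \<oplus> y" using assms by (simp add: add_mono)
  have 2: "x' \<oplus> y \<sqsubseteq> x' \<oplus> y'" using assms by (simp add: add_mono add_comm[of x'])
  show ?thesis by (rule le_trans[OF 1 2]) (simp_all add: assms add_closed)
qed

lemma is_supD:
  assumes "is_sup M X s" "\<And>n. X n \<in> carrier M"
  shows "s \<in> carrier M" "X n \<sqsubseteq> s"
  using assms by (auto simp: is_sup_def least_def Upper_def)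

lemma way_below_imp_le:
  assumes "x \<lless> y" shows "x \<sqsubseteq> y"
proof -
  have "increasing M (\<lambda>n. y)" "is_sup M (\<lambda>n. y) y"
    using assms by (auto simp: increasing_def way_below_def is_sup_def least_def Upper_def)
  then show ?thesis using assms unfolding way_below_def by blast
qed

lemma rapidly_increasing_imp_increasing:
  assumes "rapidly_increasing M X" shows "increasing M X"
  unfolding increasing_def
proof (intro conjI allI)
  fix n
  have "X n \<lless> X (Suc n)" using assms by (simp add: rapidly_increasing_def)
  then show "X n \<sqsubseteq> X (Suc n)" by (rule way_below_imp_le)
  show "X n \<in> carrier M" using \<open>X n \<lless> X (Suc n)\<close> by (simp add: way_below_def)
qed

lemma way_below_le_trans:
  assumes "x \<lless> y" "y \<sqsubseteq> z" "z \<in> carrier M" shows "x \<lless> z"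
  unfolding way_below_def
proof (intro conjI allI impI)
  show "x \<in> carrier M" "z \<in> carrier M" using assms by (auto simp: way_below_def)
  fix Y s assume Y: "increasing M Y \<and> is_sup M Y s \<and> z \<sqsubseteq> s"
  then have "s \<in> carrier M" by (auto simp: increasing_def intro: is_supD)
  then have "y \<sqsubseteq> s" using le_trans[of y z s] Y assms by (simp add: way_below_def)
  then show "\<exists>k. x \<sqsubseteq> Y k" using Y assms(1) unfolding way_below_def by blast
qed

lemma le_way_below_trans:
  assumes "x \<sqsubseteq> y" "y \<lless> z" "x \<in> carrier M" shows "x \<lless> z"
  unfolding way_below_def
proof (intro conjI allI impI)
  show "x \<in> carrier M" "z \<in> carrier M" using assms by (auto simp: way_below_def)
  fix Y s assume Y: "increasing M Y \<and> is_sup M Y s \<and> z \<sqsubseteq> s"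
  then obtain k where "y \<sqsubseteq> Y k" using assms(2) unfolding way_below_def by blast
  then have "x \<sqsubseteq> Y k"
    using le_trans[of x y "Y k"] Y assms by (simp add: way_below_def increasing_def)
  then show "\<exists>k. x \<sqsubseteq> Y k" ..
qed

lemma interval_add_in_Lambda_sigma:
  assumes "I \<in> Lambda_sigma M" "J \<in> Lambda_sigma M"
  shows "interval_add M I J \<in> Lambda_sigma M"
proof -
  have I: "interval M I" "countably_generated M I" and J: "interval M J" "countably_generated M J"
    using assms by (auto simp: Lambda_sigma_def)
  have sub: "I \<subseteq> carrier M" "J \<subseteq> carrier M" using I J by (auto simp: interval_def)
  have mem: "x \<oplus> y \<in> interval_add M I J" if "x \<in> I" "y \<in> J" for x y
    using that sub add_closed unfolding interval_add_def by blast
  have dir: "\<exists>c\<in>interval_add M I J. a \<sqsubseteq> c \<and> b \<sqsubseteq> c"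
    if a: "a \<in> interval_add M I J" and b: "b \<in> interval_add M I J" for a b
  proof -
    obtain x y x' y' where *: "x \<in> I" "y \<in> J" "a \<sqsubseteq> x \<oplus> y" "x' \<in> I" "y' \<in> J" "b \<sqsubseteq> x' \<oplus> y'"
      "a \<in> carrier M" "b \<in> carrier M"
      using a b unfolding interval_add_def by blast
    obtain u where u: "u \<in> I" "x \<sqsubseteq> u" "x' \<sqsubseteq> u" using * I unfolding interval_def by blast
    obtain v where v: "v \<in> J" "y \<sqsubseteq> v" "y' \<sqsubseteq> v" using * J unfolding interval_def by blast
    have c: "x \<in> carrier M" "y \<in> carrier M" "x' \<in> carrier M" "y' \<in> carrier M" "u \<in> carrier M"
      "v \<in> carrier M" using * u v sub by auto
    have "a \<sqsubseteq> u \<oplus> v" "b \<sqsubseteq> u \<oplus> v"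
      using le_trans[OF *(3) add_mono2[of x u y v]] le_trans[OF *(6) add_mono2[of x' u y' v]]
        * u v c add_closed by auto
    then show ?thesis using mem u v by blast
  qed
  have her: "x \<in> interval_add M I J"
    if y: "y \<in> interval_add M I J" and x: "x \<in> carrier M" "x \<sqsubseteq> y" for x y
  proof -
    obtain a b where "a \<in> I" "b \<in> J" "y \<sqsubseteq> a \<oplus> b" "y \<in> carrier M"
      using y unfolding interval_add_def by blast
    moreover from this have "a \<oplus> b \<in> carrier M" using sub add_closed by blast
    ultimately have "x \<sqsubseteq> a \<oplus> b" using le_trans[of x y "a \<oplus> b"] x by simp
    then show ?thesis using x \<open>a \<in> I\<close> \<open>b \<in> J\<close> unfolding interval_add_def by blast
  qed
  obtain x y where "x \<in> I" "y \<in> J" using I J by (auto simp: interval_def)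
  then have "interval_add M I J \<noteq> {}" using mem by blast
  moreover have "interval_add M I J \<subseteq> carrier M" by (auto simp: interval_add_def)
  ultimately have "interval M (interval_add M I J)"
    unfolding interval_def using dir her by (intro conjI ballI impI)
  moreover have "countably_generated M (interval_add M I J)"
  proof -
    obtain C where C: "C \<subseteq> I" "countable C" "\<And>x. x \<in> I \<Longrightarrow> \<exists>c\<in>C. x \<sqsubseteq> c"
      using I unfolding countably_generated_def by blast
    obtain D where D: "D \<subseteq> J" "countable D" "\<And>x. x \<in> J \<Longrightarrow> \<exists>d\<in>D. x \<sqsubseteq> d"
      using J unfolding countably_generated_def by blast
    let ?E = "(\<lambda>(c, d). c \<oplus> d) ` (C \<times> D)"
    have "\<exists>e\<in>?E. z \<sqsubseteq> e" if z: "z \<in> interval_add M I J" for z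
    proof -
      obtain x y where xy: "x \<in> I" "y \<in> J" "z \<sqsubseteq> x \<oplus> y" "z \<in> carrier M"
        using z unfolding interval_add_def by blast
      obtain c d where cd: "c \<in> C" "x \<sqsubseteq> c" "d \<in> D" "y \<sqsubseteq> d" using C(3) D(3) xy by blast
      then have "x \<in> carrier M" "y \<in> carrier M" "c \<in> carrier M" "d \<in> carrier M"
        using xy C(1) D(1) sub by auto
      then have "z \<sqsubseteq> c \<oplus> d"
        using le_trans[OF xy(3) add_mono2[of x c y d]] cd xy add_closed by auto
      then show ?thesis using cd by blast
    qed
    moreover have "?E \<subseteq> interval_add M I J" using mem C(1) D(1) by auto
    moreover have "countable ?E" using C(2) D(2) by blast
    ultimately show ?thesis unfolding countably_generated_def by blast
  qed
  ultimately show ?thesis by (simp add: Lambda_sigma_def)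
qed

end

context precu
begin

lemma interval_le_add:
  assumes sub: "I \<subseteq> carrier M" "J \<subseteq> carrier M" "I' \<subseteq> carrier M" "J' \<subseteq> carrier M"
    and le: "interval_le M I I'" "interval_le M J J'"
  shows "interval_le M (interval_add M I J) (interval_add M I' J')"
  unfolding interval_le_def
proof (intro ballI allI impI)
  fix w z assume w: "w \<in> interval_add M I J" and zw: "z \<lless> w"
  obtain x y where xy: "x \<in> I" "y \<in> J" "w \<sqsubseteq> x \<oplus> y" using w unfolding interval_add_def by blast
  have c: "x \<in> carrier M" "y \<in> carrier M" using xy sub by auto
  obtain X where X: "rapidly_increasing M X" "is_sup M X x"
    using sup_of_rapidly_increasing c by blast
  obtain Y where Y: "rapidly_increasing M Y" "is_sup M Y y"
    using sup_of_rapidly_increasing c by blast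
  have iX: "increasing M X" and iY: "increasing M Y"
    using X Y rapidly_increasing_imp_increasing by blast+
  have cX: "X n \<in> carrier M" and cY: "Y n \<in> carrier M" for n
    using iX iY by (auto simp: increasing_def)
  have "increasing M (\<lambda>n. X n \<oplus> Y n)"
    using iX iY by (simp add: increasing_def add_closed add_mono2)
  moreover have "z \<lless> x \<oplus> y" by (rule way_below_le_trans[OF zw xy(3) add_closed[OF c]])
  ultimately obtain k where k: "z \<sqsubseteq> X k \<oplus> Y k"
    using sup_add[OF iX iY X(2) Y(2)] le_refl[OF add_closed[OF c]] unfolding way_below_def by blast
  have "X k \<lless> X (Suc k)" "Y k \<lless> Y (Suc k)"
    using X Y by (simp_all add: rapidly_increasing_def)
  then have "X k \<lless> x" "Y k \<lless> y"
    using way_below_le_trans is_supD(2)[OF X(2) cX] is_supD(2)[OF Y(2) cY] c by blast+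
  then obtain a b where ab: "a \<in> I'" "X k \<lless> a" "b \<in> J'" "Y k \<lless> b"
    using le xy unfolding interval_le_def by blast
  have "z \<in> carrier M" using zw by (simp add: way_below_def)
  then have "z \<lless> a \<oplus> b" by (rule le_way_below_trans[OF k way_below_add[OF ab(2,4)]])
  moreover have "a \<oplus> b \<in> interval_add M I' J'"
    using ab sub add_closed unfolding interval_add_def by blast
  ultimately show "\<exists>y\<in>interval_add M I' J'. z \<lless> y" by blast
qed

lemma Mbar_add_class:
  assumes "I \<in> Lambda_sigma M" "J \<in> Lambda_sigma M"
  shows "sim_class M I \<oplus>\<^bsub>Mbar M\<^esub> sim_class M J = sim_class M (interval_add M I J)"
proof -
  have sub: "K \<subseteq> carrier M" if "K \<in> Lambda_sigma M" for K
    using that by (auto simp: Lambda_sigma_def interval_def)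
  have eq: "sim_class M (interval_add M I' J') = sim_class M (interval_add M I J)"
    if "I' \<in> sim_class M I" "J' \<in> sim_class M J" for I' J'
  proof -
    have "I' \<in> Lambda_sigma M" "J' \<in> Lambda_sigma M" "interval_le M I I'" "interval_le M I' I"
      "interval_le M J J'" "interval_le M J' J"
      using that by (auto simp: sim_class_def sim_rel_def)
    then show ?thesis
      using assms sub by (simp add: sim_class_eq_iff interval_add_in_Lambda_sigma interval_le_add)
  qed
  have "I \<in> sim_class M I" "J \<in> sim_class M J"
    using assms by (auto simp: sim_class_def sim_rel_def interval_le_refl)
  then have "(\<Union>I'\<in>sim_class M I. \<Union>J'\<in>sim_class M J. sim_class M (interval_add M I' J')) =
      sim_class M (interval_add M I J)"
    using eq by blast
  then show ?thesis by (simp add: Mbar_def)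
qed

end

end

theory Submission
  imports Defs
begin

text \<open>
  An interval \<open>I\<close> is determined up to equivalence by the set \<open>below I\<close> of all elements that are
  way below some member of \<open>I\<close>, and \<open>I \<precsim> J\<close> means \<open>below I \<subseteq> below J\<close>. The sets that arise are
  exactly the countably generated rounded ideals. So the quotient is the set of these ideals
  ordered by inclusion; suprema of increasing sequences are unions, and \<open>A \<lless> B\<close> holds iff
  all members of the ideal \<open>A\<close> lie under one member of the ideal \<open>B\<close>.
\<close>

text \<open>Directedness is required with \<open>\<lless>\<close> instead of
  \<open>\<sqsubseteq>\<close>. The case \<open>a = b\<close> is roundedness: every member is way
  below another member.\<close>

definition rounded_ideal :: "('a, 'm) ordered_monoid_scheme \<Rightarrow> 'a set \<Rightarrow> bool"
  where "rounded_ideal M R \<longleftrightarrow>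
    R \<subseteq> carrier M \<and> R \<noteq> {} \<and>
    (\<forall>a\<in>R. \<forall>b\<in>R. \<exists>c\<in>R. a \<lless>\<^bsub>M\<^esub> c \<and> b \<lless>\<^bsub>M\<^esub> c) \<and>
    (\<forall>b\<in>R. \<forall>a\<in>carrier M. a \<sqsubseteq>\<^bsub>M\<^esub> b \<longrightarrow> a \<in> R) \<and>
    countably_generated M R"

definition below :: "('a, 'm) ordered_monoid_scheme \<Rightarrow> 'a set \<Rightarrow> 'a set"
  where "below M I = {z. \<exists>x\<in>I. z \<lless>\<^bsub>M\<^esub> x}"

text \<open>The union over all representatives avoids choosing one; on the class of an interval
  every representative contributes the same set.\<close>

definition ideal_of :: "('a, 'm) ordered_monoid_scheme \<Rightarrow> 'a set set \<Rightarrow> 'a set"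
  where "ideal_of M A = (\<Union>I\<in>A. below M I)"

section \<open>The quotient order as inclusion of ideals\<close>

lemma interval_le_iff_below: "interval_le M I J \<longleftrightarrow> below M I \<subseteq> below M J"
  unfolding interval_le_def below_def by blast

lemma ideal_of_sim_class:
  assumes "I \<in> Lambda_sigma M"
  shows "ideal_of M (sim_class M I) = below M I"
proof -
  have "I \<in> sim_class M I"
    using assms by (simp add: sim_class_def sim_rel_def interval_le_refl)
  moreover have "below M J = below M I" if "J \<in> sim_class M I" for J
    using that by (auto simp: sim_class_def sim_rel_def interval_le_iff_below)
  ultimately show ?thesis unfolding ideal_of_def by blast
qed

lemma Mbar_le_iff:
  assumes "A \<in> carrier (Mbar M)" "B \<in> carrier (Mbar M)"
  shows "A \<sqsubseteq>\<^bsub>Mbar M\<^esub> B \<longleftrightarrow> ideal_of M A \<subseteq> ideal_of M B"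
  using assms
  by (auto simp: Mbar_carrier Mbar_le_class ideal_of_sim_class interval_le_iff_below)

text \<open>Equivalence of intervals is comparison in both directions, hence equality of ideals.
  Equations in the quotient can thus be proved as equations between sets.\<close>

lemma Mbar_eq_iff:
  assumes "A \<in> carrier (Mbar M)" "B \<in> carrier (Mbar M)"
  shows "A = B \<longleftrightarrow> ideal_of M A = ideal_of M B"
proof -
  obtain I J where "I \<in> Lambda_sigma M" "A = sim_class M I" "J \<in> Lambda_sigma M" "B = sim_class M J"
    using assms by (auto simp: Mbar_carrier)
  then show ?thesis
    by (auto simp only: sim_class_eq_iff ideal_of_sim_class interval_le_iff_below)
qed

lemma Mbar_eqI:
  assumes "A \<in> carrier (Mbar M)" "B \<in> carrier (Mbar M)" "ideal_of M A = ideal_of M B"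
  shows "A = B"
  using Mbar_eq_iff[OF assms(1,2)] assms(3) by blast

lemma interval_add_subset: "\<lbrakk>I \<subseteq> I'; J \<subseteq> J'\<rbrakk> \<Longrightarrow> interval_add M I J \<subseteq> interval_add M I' J'"
  unfolding interval_add_def by blast

section \<open>Elementary facts on ordered monoids and sums of intervals\<close>

context ordered_monoid
begin

lemma way_below_carrier:
  assumes "x \<lless> y"
  shows "x \<in> carrier M" "y \<in> carrier M"
  using assms by (simp_all add: way_below_def)

lemma zero_closed [simp]: "\<zero> \<in> carrier M"
  using omon.one_closed by (simp add: omonoid_def)

lemma add_assoc:
  "\<lbrakk>x \<in> carrier M; y \<in> carrier M; z \<in> carrier M\<rbrakk> \<Longrightarrow> x \<oplus> y \<oplus> z = x \<oplus> (y \<oplus> z)"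
  using omon.m_assoc by (simp add: omonoid_def)

lemma zero_add: "x \<in> carrier M \<Longrightarrow> \<zero> \<oplus> x = x"
  using omon.l_one by (simp add: omonoid_def)

lemma increasing_le:
  assumes "increasing M X" "m \<le> n"
  shows "X m \<sqsubseteq> X n"
  using assms(2)
proof (induction rule: dec_induct)
  case base
  then show ?case using assms(1) by (simp add: increasing_def)
next
  case (step n)
  then show ?case
    using assms(1) le_trans[of "X m" "X n" "X (Suc n)"] by (simp add: increasing_def)
qed

lemma is_sup_least:
  assumes "is_sup M X s" "\<And>n. X n \<sqsubseteq> u" "u \<in> carrier M" "\<And>n. X n \<in> carrier M"
  shows "s \<sqsubseteq> u"
  using assms unfolding is_sup_def least_def Upper_def by blast

lemma is_supI:
  assumes "s \<in> carrier M" "\<And>n. X n \<in> carrier M" "\<And>n. X n \<sqsubseteq> s"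
    and "\<And>u. \<lbrakk>u \<in> carrier M; \<And>n. X n \<sqsubseteq> u\<rbrakk> \<Longrightarrow> s \<sqsubseteq> u"
  shows "is_sup M X s"
  using assms by (auto simp: is_sup_def least_def Upper_def)

lemma rapidly_increasing_way_below_sup:
  assumes "rapidly_increasing M X" "is_sup M X x"
  shows "X n \<lless> x"
proof -
  have X: "X n \<in> carrier M" for n
    using rapidly_increasing_imp_increasing[OF assms(1)] by (simp add: increasing_def)
  have "X n \<lless> X (Suc n)" using assms(1) by (simp add: rapidly_increasing_def)
  then show ?thesis by (rule way_below_le_trans) (rule is_supD[OF assms(2) X])+
qed

lemma principal_interval_in_Lambda_sigma:
  assumes "x \<in> carrier M"
  shows "principal_interval M x \<in> Lambda_sigma M"
proof -
  have x: "x \<in> principal_interval M x" using assms by (simp add: principal_interval_def)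
  have le_x: "y \<sqsubseteq> x" if "y \<in> principal_interval M x" for y
    using that by (simp add: principal_interval_def)
  have down: "z \<in> principal_interval M x"
    if "y \<in> principal_interval M x" "z \<in> carrier M" "z \<sqsubseteq> y" for y z
    using that assms le_trans[of z y x] by (simp add: principal_interval_def)
  have "interval M (principal_interval M x)"
    unfolding interval_def
  proof (intro conjI ballI impI)
    show "principal_interval M x \<subseteq> carrier M" by (auto simp: principal_interval_def)
    show "principal_interval M x \<noteq> {}" using x by blast
    show "\<exists>w\<in>principal_interval M x. y \<sqsubseteq> w \<and> z \<sqsubseteq> w"
      if "y \<in> principal_interval M x" "z \<in> principal_interval M x" for y z
      using x that[THEN le_x] by blast
  qed (rule down)
  moreover have "countably_generated M (principal_interval M x)"
    unfolding countably_generated_def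
    using x by (intro exI[of _ "{x}"]) (auto simp: principal_interval_def)
  ultimately show ?thesis by (simp add: Lambda_sigma_def)
qed

text \<open>\<open>x\<close> is the greatest member of its interval, so it absorbs every other
  witness.\<close>

lemma below_principal_interval:
  assumes "x \<in> carrier M"
  shows "below M (principal_interval M x) = {z. z \<lless> x}"
proof -
  have "z \<lless> x" if "z \<lless> y" "y \<in> principal_interval M x" for y z
    using that way_below_le_trans[OF that(1) _ assms] by (simp add: principal_interval_def)
  moreover have "x \<in> principal_interval M x" using assms by (simp add: principal_interval_def)
  ultimately show ?thesis unfolding below_def by blast
qed

lemma interval_add_principal:
  assumes "x \<in> carrier M" "y \<in> carrier M"
  shows "interval_add M (principal_interval M x) (principal_interval M y) =
    principal_interval M (x \<oplus> y)"
proof (intro equalityI subsetI)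
  fix z assume "z \<in> interval_add M (principal_interval M x) (principal_interval M y)"
  then obtain a b where ab: "a \<in> carrier M" "b \<in> carrier M" "a \<sqsubseteq> x" "b \<sqsubseteq> y" "z \<sqsubseteq> a \<oplus> b"
    "z \<in> carrier M"
    by (auto simp: interval_add_def principal_interval_def)
  then have "z \<sqsubseteq> x \<oplus> y"
    using le_trans[OF ab(5) add_mono2[of a x b y]] assms add_closed by auto
  then show "z \<in> principal_interval M (x \<oplus> y)"
    using ab by (simp add: principal_interval_def)
next
  fix z assume "z \<in> principal_interval M (x \<oplus> y)"
  then show "z \<in> interval_add M (principal_interval M x) (principal_interval M y)"
    using assms by (force simp: interval_add_def principal_interval_def)
qed

lemma add_in_interval_add:
  assumes "x \<in> I" "y \<in> J" "I \<subseteq> carrier M" "J \<subseteq> carrier M"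
  shows "x \<oplus> y \<in> interval_add M I J"
proof -
  have "x \<oplus> y \<in> carrier M" using assms add_closed by blast
  then show ?thesis using assms le_refl[of "x \<oplus> y"] unfolding interval_add_def by blast
qed

text \<open>Monotonicity of addition removes the intermediate element of the inner sum. Comparing
  this description for \<open>I, J, K\<close> and for \<open>J, K, I\<close> later yields
  associativity in the quotient.\<close>

lemma interval_add_assoc:
  assumes "I \<subseteq> carrier M" "J \<subseteq> carrier M" "K \<subseteq> carrier M"
  shows "interval_add M (interval_add M I J) K =
    {z \<in> carrier M. \<exists>x\<in>I. \<exists>y\<in>J. \<exists>w\<in>K. z \<sqsubseteq> x \<oplus> y \<oplus> w}"
proof (intro equalityI subsetI)
  fix z assume "z \<in> interval_add M (interval_add M I J) K"
  then obtain v x y w where v: "v \<in> carrier M" "x \<in> I" "y \<in> J" "w \<in> K" "v \<sqsubseteq> x \<oplus> y"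
    "z \<sqsubseteq> v \<oplus> w" "z \<in> carrier M"
    by (auto simp: interval_add_def)
  then have c: "x \<in> carrier M" "y \<in> carrier M" "w \<in> carrier M" using assms by auto
  have "z \<sqsubseteq> x \<oplus> y \<oplus> w"
    by (rule le_trans[OF v(6) add_mono[OF v(1) _ _ v(5)]]) (simp_all add: v c add_closed)
  then show "z \<in> {z \<in> carrier M. \<exists>x\<in>I. \<exists>y\<in>J. \<exists>w\<in>K. z \<sqsubseteq> x \<oplus> y \<oplus> w}" using v by blast
next
  fix z assume "z \<in> {z \<in> carrier M. \<exists>x\<in>I. \<exists>y\<in>J. \<exists>w\<in>K. z \<sqsubseteq> x \<oplus> y \<oplus> w}"
  then obtain x y w where "x \<in> I" "y \<in> J" "w \<in> K" "z \<sqsubseteq> x \<oplus> y \<oplus> w" "z \<in> carrier M" by blast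
  moreover from this have "x \<oplus> y \<in> interval_add M I J"
    using assms by (blast intro: add_in_interval_add)
  ultimately show "z \<in> interval_add M (interval_add M I J) K"
    unfolding interval_add_def[of M "interval_add M I J"] by blast
qed

lemma interval_add_comm:
  assumes "I \<subseteq> carrier M" "J \<subseteq> carrier M"
  shows "interval_add M I J = interval_add M J I"
proof -
  have "interval_add M I J \<subseteq> interval_add M J I"
    if "I \<subseteq> carrier M" "J \<subseteq> carrier M" for I J
  proof
    fix z assume "z \<in> interval_add M I J"
    then obtain x y where "x \<in> I" "y \<in> J" "z \<sqsubseteq> x \<oplus> y" "z \<in> carrier M"
      by (auto simp: interval_add_def)
    moreover from this have "x \<oplus> y = y \<oplus> x" using that add_comm by blast
    ultimately show "z \<in> interval_add M J I" by (auto simp: interval_add_def)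
  qed
  then show ?thesis using assms by blast
qed

section \<open>Rounded ideals: generating sequences and unions\<close>

lemma rounded_ideal_in_Lambda_sigma:
  assumes "rounded_ideal M R"
  shows "R \<in> Lambda_sigma M"
proof -
  have "\<exists>c\<in>R. a \<sqsubseteq> c \<and> b \<sqsubseteq> c" if "a \<in> R" "b \<in> R" for a b
    using that assms way_below_imp_le unfolding rounded_ideal_def by meson
  then show ?thesis
    using assms unfolding rounded_ideal_def Lambda_sigma_def interval_def by blast
qed

text \<open>Downward closure gives one inclusion, roundedness the other. Hence a rounded ideal,
  viewed as an interval, represents the class whose ideal it is.\<close>

lemma below_rounded_ideal:
  assumes "rounded_ideal M R"
  shows "below M R = R"
proof (intro equalityI subsetI)
  fix z assume "z \<in> below M R"
  then obtain x where "x \<in> R" "z \<lless> x" by (auto simp: below_def)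
  then show "z \<in> R"
    using assms way_below_imp_le way_below_carrier unfolding rounded_ideal_def by meson
next
  fix z assume "z \<in> R"
  then show "z \<in> below M R" using assms unfolding rounded_ideal_def below_def by blast
qed

lemma rounded_ideal_directed:
  assumes "rounded_ideal M R" "a \<in> R" "b \<in> R"
  obtains c where "c \<in> R" "a \<lless> c" "b \<lless> c"
  using assms unfolding rounded_ideal_def by blast

lemma rounded_ideal_down:
  assumes "rounded_ideal M R" "b \<in> R" "a \<in> carrier M" "a \<sqsubseteq> b"
  shows "a \<in> R"
  using assms unfolding rounded_ideal_def by blast

text \<open>Dependent choice along an enumeration of a countable cofinal set: the next term is taken
  way above both the current term and the current generator.\<close>

lemma rounded_ideal_generator:
  assumes "rounded_ideal M R"
  obtains W where "rapidly_increasing M W" "\<And>n. W n \<in> R" "\<And>z. z \<in> R \<Longrightarrow> \<exists>n. z \<lless> W n"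
proof -
  obtain C where C: "C \<subseteq> R" "countable C" "\<And>x. x \<in> R \<Longrightarrow> \<exists>c\<in>C. x \<sqsubseteq> c"
    using assms unfolding rounded_ideal_def countably_generated_def by blast
  have "C \<noteq> {}" using C(3) assms unfolding rounded_ideal_def by blast
  \<comment> \<open>Repetitions are harmless here, so \<open>C\<close> may be finite; being nonempty
    and countable, it is the whole range of \<open>e\<close>.\<close>
  define e where "e = from_nat_into C"
  have e: "range e = C" unfolding e_def using \<open>C \<noteq> {}\<close> C(2) by (rule range_from_nat_into)
  have "\<exists>W. \<forall>n. W n \<in> R \<and> (W n \<lless> W (Suc n) \<and> e n \<lless> W (Suc n))"
  proof (rule dependent_nat_choice)
    show "\<exists>x. x \<in> R" using assms unfolding rounded_ideal_def by blast
    show "\<exists>y. y \<in> R \<and> (x \<lless> y \<and> e n \<lless> y)" if "x \<in> R" for x n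
    proof -
      have "e n \<in> R" using C(1) e by blast
      then obtain y where "y \<in> R" "x \<lless> y" "e n \<lless> y"
        using rounded_ideal_directed[OF assms \<open>x \<in> R\<close>] by blast
      then show ?thesis by blast
    qed
  qed
  then obtain W where W: "\<And>n. W n \<in> R" "\<And>n. W n \<lless> W (Suc n)" "\<And>n. e n \<lless> W (Suc n)"
    by blast
  have "\<exists>n. z \<lless> W n" if z: "z \<in> R" for z
  proof -
    obtain n where n: "z \<sqsubseteq> e n" using C(3)[OF z] e by blast
    have "z \<in> carrier M" using z assms unfolding rounded_ideal_def by blast
    then show ?thesis using le_way_below_trans[OF n W(3)] by blast
  qed
  then show ?thesis using W by (intro that[of W]) (simp_all add: rapidly_increasing_def)
qed

text \<open>Two members of the union lie in a common stage, where directedness applies; countable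
  cofinal subsets of the stages have a countable cofinal union.\<close>

lemma rounded_ideal_Union:
  assumes R: "\<And>n::nat. rounded_ideal M (R n)" and mono: "\<And>n. R n \<subseteq> R (Suc n)"
  shows "rounded_ideal M (\<Union>n. R n)"
proof -
  have le: "R m \<subseteq> R n" if "m \<le> n" for m n
    using lift_Suc_mono_le[of R, OF mono that] .
  have "\<exists>c\<in>\<Union>n. R n. a \<lless> c \<and> b \<lless> c" if ab: "a \<in> (\<Union>n. R n)" "b \<in> (\<Union>n. R n)" for a b
  proof -
    obtain i j where "a \<in> R i" "b \<in> R j" using ab by blast
    then have "a \<in> R (max i j)" "b \<in> R (max i j)"
      using le[of i "max i j"] le[of j "max i j"] by auto
    then show ?thesis using rounded_ideal_directed[OF R] by (metis UN_I UNIV_I)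
  qed
  moreover have "countably_generated M (\<Union>n. R n)"
  proof -
    have "\<forall>n. \<exists>C\<subseteq>R n. countable C \<and> (\<forall>x\<in>R n. \<exists>c\<in>C. x \<sqsubseteq> c)"
      using R unfolding rounded_ideal_def countably_generated_def by blast
    then obtain C where "\<And>n. C n \<subseteq> R n" "\<And>n. countable (C n)"
      "\<And>n. \<forall>x\<in>R n. \<exists>c\<in>C n. x \<sqsubseteq> c"
      by metis
    then show ?thesis
      unfolding countably_generated_def by (intro exI[of _ "\<Union>n. C n"]) (auto, blast)
  qed
  moreover have "(\<Union>n. R n) \<subseteq> carrier M"
    using R by (intro UN_least) (simp add: rounded_ideal_def)
  moreover have "(\<Union>n. R n) \<noteq> {}"
    using R[of 0] unfolding rounded_ideal_def by blast
  moreover have "\<forall>b\<in>\<Union>n. R n. \<forall>a\<in>carrier M. a \<sqsubseteq> b \<longrightarrow> a \<in> (\<Union>n. R n)"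
    using rounded_ideal_down[OF R] by blast
  ultimately show ?thesis unfolding rounded_ideal_def by (intro conjI) blast+
qed

end

section \<open>The correspondence between classes and rounded ideals\<close>

context precu
begin

text \<open>This is where interpolation for \<open>\<lless>\<close> comes from: if
  \<open>a \<lless> w\<close>, then \<open>a\<close> lies under some term of a rapidly increasing
  sequence with supremum \<open>w\<close>, and the next term fits strictly between.\<close>

lemma rounded_ideal_below:
  assumes "I \<in> Lambda_sigma M"
  shows "rounded_ideal M (below M I)"
proof -
  have I: "I \<subseteq> carrier M" "I \<noteq> {}" "\<And>x y. \<lbrakk>x \<in> I; y \<in> I\<rbrakk> \<Longrightarrow> \<exists>z\<in>I. x \<sqsubseteq> z \<and> y \<sqsubseteq> z"
    using assms by (auto simp: Lambda_sigma_def interval_def)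
  \<comment> \<open>One approximating sequence is fixed for each element; these sequences serve both
    directedness and countable generation.\<close>
  have "\<exists>S. \<forall>x\<in>carrier M. rapidly_increasing M (S x) \<and> is_sup M (S x) x"
    using sup_of_rapidly_increasing by metis
  then obtain S where S: "\<And>x. x \<in> carrier M \<Longrightarrow> rapidly_increasing M (S x)"
    "\<And>x. x \<in> carrier M \<Longrightarrow> is_sup M (S x) x"
    by blast
  have inc: "increasing M (S x)" if "x \<in> carrier M" for x
    using S(1)[OF that] by (rule rapidly_increasing_imp_increasing)
  have S_below: "S x n \<lless> x" if "x \<in> carrier M" for x n
    using rapidly_increasing_way_below_sup S that by blast
  have S_cofinal: "\<exists>n. z \<sqsubseteq> S x n" if "z \<lless> x" for z x
    using that inc S(2) le_refl unfolding way_below_def by blast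
  have "\<exists>c\<in>below M I. a \<lless> c \<and> b \<lless> c" if ab: "a \<in> below M I" "b \<in> below M I" for a b
  proof -
    obtain x y where "x \<in> I" "a \<lless> x" "y \<in> I" "b \<lless> y" using ab by (auto simp: below_def)
    moreover then obtain w where w: "w \<in> I" "x \<sqsubseteq> w" "y \<sqsubseteq> w" using I(3) by blast
    ultimately have aw: "a \<lless> w" "b \<lless> w" using way_below_le_trans I(1) by blast+
    obtain i j where ij: "a \<sqsubseteq> S w i" "b \<sqsubseteq> S w j" using S_cofinal aw by blast
    let ?k = "max i j"
    have wc: "w \<in> carrier M" using w I by blast
    have "S w i \<sqsubseteq> S w ?k" "S w j \<sqsubseteq> S w ?k"
      using increasing_le[OF inc[OF wc]] by simp_all
    then have "a \<sqsubseteq> S w ?k" "b \<sqsubseteq> S w ?k"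
      using le_trans[OF ij(1)] le_trans[OF ij(2)] aw[THEN way_below_carrier(1)] inc[OF wc]
      by (simp_all add: increasing_def)
    \<comment> \<open>Moving one index further turns the bound \<open>\<sqsubseteq>\<close> into
      \<open>\<lless>\<close>, while the term stays way below \<open>w\<close>.\<close>
    moreover have "S w ?k \<lless> S w (Suc ?k)"
      using S(1)[OF wc] by (simp add: rapidly_increasing_def)
    ultimately have "a \<lless> S w (Suc ?k)" "b \<lless> S w (Suc ?k)"
      using le_way_below_trans aw[THEN way_below_carrier(1)] by blast+
    moreover have "S w (Suc ?k) \<in> below M I"
      using S_below[OF wc] w(1) unfolding below_def by blast
    ultimately show ?thesis by blast
  qed
  moreover have "countably_generated M (below M I)"
  proof -
    obtain C where C: "C \<subseteq> I" "countable C" "\<And>x. x \<in> I \<Longrightarrow> \<exists>c\<in>C. x \<sqsubseteq> c"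
      using assms unfolding Lambda_sigma_def countably_generated_def by blast
    let ?E = "\<Union>c\<in>C. range (S c)"
    have "\<exists>e\<in>?E. z \<sqsubseteq> e" if z: "z \<in> below M I" for z
    proof -
      obtain x where x: "x \<in> I" "z \<lless> x" using z by (auto simp: below_def)
      then obtain c where c: "c \<in> C" "x \<sqsubseteq> c" using C(3) by blast
      then have "z \<lless> c" using way_below_le_trans x C(1) I(1) by blast
      then show ?thesis using S_cofinal c by blast
    qed
    moreover have "?E \<subseteq> below M I" using S_below C(1) I(1) unfolding below_def by blast
    moreover have "countable ?E" using C(2) by simp
    ultimately show ?thesis unfolding countably_generated_def by blast
  qed
  moreover have "below M I \<subseteq> carrier M" using way_below_carrier by (auto simp: below_def)
  moreover have "below M I \<noteq> {}"
    using I(1,2) S_below unfolding below_def by blast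
  moreover have "\<forall>b\<in>below M I. \<forall>a\<in>carrier M. a \<sqsubseteq> b \<longrightarrow> a \<in> below M I"
    using le_way_below_trans unfolding below_def by blast
  ultimately show ?thesis unfolding rounded_ideal_def by blast
qed

lemma rounded_ideal_ideal_of:
  assumes "A \<in> carrier (Mbar M)"
  shows "rounded_ideal M (ideal_of M A)"
  using assms rounded_ideal_below by (auto simp: Mbar_carrier ideal_of_sim_class)

lemma ideal_of_subset_carrier: "A \<in> carrier (Mbar M) \<Longrightarrow> ideal_of M A \<subseteq> carrier M"
  using rounded_ideal_ideal_of unfolding rounded_ideal_def by blast

text \<open>Every rounded ideal occurs: it is the ideal of its own class, since \<open>below\<close>
  fixes it.\<close>

lemma ex_ideal_of:
  assumes "rounded_ideal M R"
  obtains A where "A \<in> carrier (Mbar M)" "ideal_of M A = R"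
  using assms that[of "sim_class M R"] rounded_ideal_in_Lambda_sigma
  by (simp add: Mbar_carrier ideal_of_sim_class below_rounded_ideal)

lemma iota_closed: "x \<in> carrier M \<Longrightarrow> iota M x \<in> carrier (Mbar M)"
  by (simp add: iota_def Mbar_carrier principal_interval_in_Lambda_sigma)

lemma ideal_of_iota: "x \<in> carrier M \<Longrightarrow> ideal_of M (iota M x) = {z. z \<lless> x}"
  by (simp add: iota_def ideal_of_sim_class principal_interval_in_Lambda_sigma
      below_principal_interval)

section \<open>The ordered monoid structure of the quotient\<close>

lemma Mbar_zero: "\<zero>\<^bsub>Mbar M\<^esub> = iota M \<zero>"
  by (simp add: Mbar_def iota_def)

lemma Mbar_add_closed:
  assumes "A \<in> carrier (Mbar M)" "B \<in> carrier (Mbar M)"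
  shows "A \<oplus>\<^bsub>Mbar M\<^esub> B \<in> carrier (Mbar M)"
  using assms by (auto simp: Mbar_carrier Mbar_add_class interval_add_in_Lambda_sigma)

lemma iota_add:
  assumes "x \<in> carrier M" "y \<in> carrier M"
  shows "iota M (x \<oplus> y) = iota M x \<oplus>\<^bsub>Mbar M\<^esub> iota M y"
  using assms
  by (simp add: iota_def Mbar_add_class principal_interval_in_Lambda_sigma interval_add_principal)

text \<open>
  Replacing \<open>I\<close> and \<open>J\<close> by the equivalent intervals \<open>below I\<close> and \<open>below J\<close> leaves the class of
  \<open>I + J\<close> unchanged, and the sum of two rounded ideals is already rounded.
\<close>
lemma ideal_of_add:
  assumes "A \<in> carrier (Mbar M)" "B \<in> carrier (Mbar M)"
  shows "ideal_of M (A \<oplus>\<^bsub>Mbar M\<^esub> B) = interval_add M (ideal_of M A) (ideal_of M B)"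
proof -
  let ?R = "ideal_of M A" and ?S = "ideal_of M B"
  have R: "rounded_ideal M ?R" and S: "rounded_ideal M ?S"
    using assms rounded_ideal_ideal_of by blast+
  have L: "?R \<in> Lambda_sigma M" "?S \<in> Lambda_sigma M"
    using R S rounded_ideal_in_Lambda_sigma by blast+
  have "A = sim_class M ?R" "B = sim_class M ?S"
    using assms L R S
    by (simp_all add: Mbar_eq_iff Mbar_carrier ideal_of_sim_class below_rounded_ideal)
  then have "ideal_of M (A \<oplus>\<^bsub>Mbar M\<^esub> B) = below M (interval_add M ?R ?S)"
    using L Mbar_add_class ideal_of_sim_class interval_add_in_Lambda_sigma by metis
  also have "\<dots> = interval_add M ?R ?S"
  proof (intro equalityI subsetI)
    fix z assume "z \<in> below M (interval_add M ?R ?S)"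
    then obtain w where w: "w \<in> interval_add M ?R ?S" "z \<lless> w" by (auto simp: below_def)
    then have "z \<in> carrier M" "z \<sqsubseteq> w"
      by (simp_all add: way_below_carrier(1) way_below_imp_le)
    then show "z \<in> interval_add M ?R ?S"
      using interval_add_in_Lambda_sigma[OF L] w(1)
      by (auto simp: Lambda_sigma_def interval_def)
  next
    fix z assume z: "z \<in> interval_add M ?R ?S"
    then obtain a b where ab: "a \<in> ?R" "b \<in> ?S" "z \<sqsubseteq> a \<oplus> b" "z \<in> carrier M"
      by (auto simp: interval_add_def)
    obtain a' where a': "a' \<in> ?R" "a \<lless> a'" using rounded_ideal_directed[OF R ab(1,1)] .
    obtain b' where b': "b' \<in> ?S" "b \<lless> b'" using rounded_ideal_directed[OF S ab(2,2)] .
    have "z \<lless> a' \<oplus> b'"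
      by (rule le_way_below_trans[OF ab(3) way_below_add[OF a'(2) b'(2)] ab(4)])
    moreover have "a' \<oplus> b' \<in> interval_add M ?R ?S"
      using a'(1) b'(1) assms[THEN ideal_of_subset_carrier] by (rule add_in_interval_add)
    ultimately show "z \<in> below M (interval_add M ?R ?S)" unfolding below_def by blast
  qed
  finally show ?thesis .
qed

lemma Mbar_add_comm:
  assumes "A \<in> carrier (Mbar M)" "B \<in> carrier (Mbar M)"
  shows "A \<oplus>\<^bsub>Mbar M\<^esub> B = B \<oplus>\<^bsub>Mbar M\<^esub> A"
  using assms interval_add_comm[OF assms[THEN ideal_of_subset_carrier]]
  by (intro Mbar_eqI[of _ M]) (simp_all add: Mbar_add_closed ideal_of_add)

lemma Mbar_add_assoc:
  assumes "A \<in> carrier (Mbar M)" "B \<in> carrier (Mbar M)" "C \<in> carrier (Mbar M)"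
  shows "A \<oplus>\<^bsub>Mbar M\<^esub> B \<oplus>\<^bsub>Mbar M\<^esub> C = A \<oplus>\<^bsub>Mbar M\<^esub> (B \<oplus>\<^bsub>Mbar M\<^esub> C)"
proof -
  note sub = assms[THEN ideal_of_subset_carrier]
  have rot: "x \<oplus> y \<oplus> w = y \<oplus> w \<oplus> x"
    if "x \<in> ideal_of M A" "y \<in> ideal_of M B" "w \<in> ideal_of M C" for x y w
  proof -
    have "x \<in> carrier M" "y \<in> carrier M" "w \<in> carrier M" using that sub by auto
    then show ?thesis
      using add_assoc[of x y w] add_comm[of x "y \<oplus> w"] add_closed[of y w] by simp
  qed
  have "(\<exists>x\<in>ideal_of M A. \<exists>y\<in>ideal_of M B. \<exists>w\<in>ideal_of M C. z \<sqsubseteq> x \<oplus> y \<oplus> w) \<longleftrightarrow>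
      (\<exists>x\<in>ideal_of M A. \<exists>y\<in>ideal_of M B. \<exists>w\<in>ideal_of M C. z \<sqsubseteq> y \<oplus> w \<oplus> x)" for z
    by (intro bex_cong HOL.refl arg_cong[of _ _ "\<lambda>t. z \<sqsubseteq> t"]) (rule rot)
  \<comment> \<open>Only left-nested triple sums are compared, in rotated order; commutativity in
    the quotient then moves the brackets.\<close>
  then have "interval_add M (interval_add M (ideal_of M A) (ideal_of M B)) (ideal_of M C) =
      interval_add M (interval_add M (ideal_of M B) (ideal_of M C)) (ideal_of M A)"
    unfolding interval_add_assoc[OF sub] interval_add_assoc[OF sub(2,3,1)] by blast
  then have "A \<oplus>\<^bsub>Mbar M\<^esub> B \<oplus>\<^bsub>Mbar M\<^esub> C = B \<oplus>\<^bsub>Mbar M\<^esub> C \<oplus>\<^bsub>Mbar M\<^esub> A"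
    using assms by (intro Mbar_eqI[of _ M]) (simp_all add: Mbar_add_closed ideal_of_add)
  then show ?thesis using assms by (simp add: Mbar_add_comm Mbar_add_closed)
qed

text \<open>Whatever is way below zero lies under zero, hence under any member \<open>a\<close> of
  the given ideal, and downward closure applies.\<close>

lemma Mbar_zero_le:
  assumes "A \<in> carrier (Mbar M)"
  shows "\<zero>\<^bsub>Mbar M\<^esub> \<sqsubseteq>\<^bsub>Mbar M\<^esub> A"
proof -
  have R: "rounded_ideal M (ideal_of M A)" using assms by (rule rounded_ideal_ideal_of)
  then obtain a where a: "a \<in> ideal_of M A" "a \<in> carrier M"
    unfolding rounded_ideal_def by blast
  have "z \<in> ideal_of M A" if "z \<lless> \<zero>" for z
  proof -
    have "z \<in> carrier M" "z \<sqsubseteq> \<zero>" using that way_below_carrier way_below_imp_le by blast+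
    then have "z \<sqsubseteq> a" using le_trans[of z \<zero> a] zero_least a by simp
    then show ?thesis using rounded_ideal_down[OF R a(1)] \<open>z \<in> carrier M\<close> by blast
  qed
  then show ?thesis
    using assms by (auto simp: Mbar_le_iff Mbar_zero iota_closed ideal_of_iota)
qed

text \<open>Computed on a representative: an interval is downward closed, so adding the interval of
  zero returns exactly the same set, not just an equivalent one.\<close>

lemma Mbar_zero_add:
  assumes "A \<in> carrier (Mbar M)"
  shows "\<zero>\<^bsub>Mbar M\<^esub> \<oplus>\<^bsub>Mbar M\<^esub> A = A"
proof -
  obtain I where I: "I \<in> Lambda_sigma M" "A = sim_class M I"
    using assms by (auto simp: Mbar_carrier)
  then have sub: "I \<subseteq> carrier M" and down: "\<And>x y. \<lbrakk>y \<in> I; x \<in> carrier M; x \<sqsubseteq> y\<rbrakk> \<Longrightarrow> x \<in> I"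
    by (auto simp: Lambda_sigma_def interval_def)
  have "interval_add M (principal_interval M \<zero>) I = I"
  proof (intro equalityI subsetI)
    fix z assume "z \<in> interval_add M (principal_interval M \<zero>) I"
    then obtain a y where ay: "a \<in> carrier M" "a \<sqsubseteq> \<zero>" "y \<in> I" "z \<sqsubseteq> a \<oplus> y" "z \<in> carrier M"
      by (auto simp: interval_add_def principal_interval_def)
    have "y \<in> carrier M" using ay sub by blast
    then have "a \<oplus> y \<sqsubseteq> y" using add_mono[of a \<zero> y] ay zero_add by simp
    then have "z \<sqsubseteq> y" using le_trans[OF ay(4)] ay add_closed \<open>y \<in> carrier M\<close> by blast
    then show "z \<in> I" using down ay by blast
  next
    fix z assume "z \<in> I"
    then show "z \<in> interval_add M (principal_interval M \<zero>) I"
      using sub add_in_interval_add[of \<zero> "principal_interval M \<zero>" z I] zero_add[of z]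
      by (auto simp: principal_interval_def)
  qed
  then show ?thesis
    using I by (simp add: Mbar_zero iota_def Mbar_add_class principal_interval_in_Lambda_sigma)
qed

lemma ordered_monoid_Mbar: "ordered_monoid (Mbar M)"
proof (intro ordered_monoid.intro ordered_monoid_axioms.intro)
  have "eq (Mbar M) = (=)" by (simp add: Mbar_def)
  then show "partial_order (Mbar M)"
    \<comment> \<open>The order axioms reduce to those of set inclusion; antisymmetry uses that a
      class is determined by its ideal.\<close>
    by unfold_locales (auto simp: Mbar_le_iff Mbar_eq_iff)
  show "comm_monoid (omonoid (Mbar M))"
  proof (rule comm_monoidI, unfold omonoid_def monoid.simps partial_object.simps)
    show "\<zero>\<^bsub>Mbar M\<^esub> \<in> carrier (Mbar M)" by (simp add: Mbar_zero iota_closed)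
  qed (fact Mbar_add_closed Mbar_add_assoc Mbar_zero_add Mbar_add_comm)+
  show "A \<oplus>\<^bsub>Mbar M\<^esub> C \<sqsubseteq>\<^bsub>Mbar M\<^esub> B \<oplus>\<^bsub>Mbar M\<^esub> C"
    if "A \<in> carrier (Mbar M)" "B \<in> carrier (Mbar M)" "C \<in> carrier (Mbar M)" "A \<sqsubseteq>\<^bsub>Mbar M\<^esub> B" for A B C
    using that by (simp add: Mbar_le_iff Mbar_add_closed ideal_of_add interval_add_subset)
  show "\<zero>\<^bsub>Mbar M\<^esub> \<sqsubseteq>\<^bsub>Mbar M\<^esub> A" if "A \<in> carrier (Mbar M)" for A
    using that by (rule Mbar_zero_le)
qed

text \<open>Makes the general facts on suprema and \<open>\<lless>\<close> available for the
  quotient before it is known to lie in PreCu.\<close>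

interpretation Mbar: ordered_monoid "Mbar M"
  by (rule ordered_monoid_Mbar)

section \<open>Suprema of increasing sequences in the quotient\<close>

lemma increasing_Mbar_iff:
  "increasing (Mbar M) X \<longleftrightarrow>
    (\<forall>n. X n \<in> carrier (Mbar M)) \<and> (\<forall>n. ideal_of M (X n) \<subseteq> ideal_of M (X (Suc n)))"
  unfolding increasing_def by (intro conj_cong HOL.refl all_cong1) (simp add: Mbar_le_iff)

lemma ex_ideal_of_Union:
  assumes "increasing (Mbar M) X"
  obtains A where "A \<in> carrier (Mbar M)" "ideal_of M A = (\<Union>n. ideal_of M (X n))"
proof -
  have "rounded_ideal M (\<Union>n. ideal_of M (X n))"
    using assms by (intro rounded_ideal_Union rounded_ideal_ideal_of)
      (auto simp: increasing_Mbar_iff)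
  then show ?thesis using that by (rule ex_ideal_of)
qed

lemma is_sup_Mbar_iff:
  assumes "increasing (Mbar M) X"
  shows "is_sup (Mbar M) X A \<longleftrightarrow>
    A \<in> carrier (Mbar M) \<and> ideal_of M A = (\<Union>n. ideal_of M (X n))"
proof
  have X: "\<And>n. X n \<in> carrier (Mbar M)" using assms by (simp add: increasing_def)
  obtain B where B: "B \<in> carrier (Mbar M)" "ideal_of M B = (\<Union>n. ideal_of M (X n))"
    using assms by (rule ex_ideal_of_Union)
  assume A: "is_sup (Mbar M) X A"
  then have Ac: "A \<in> carrier (Mbar M)" and XA: "\<And>n. X n \<sqsubseteq>\<^bsub>Mbar M\<^esub> A"
    using Mbar.is_supD X by blast+
  \<comment> \<open>The union is itself the ideal of a class \<open>B\<close>, which is an upper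
    bound; so the supremum cannot have a larger ideal.\<close>
  have "A \<sqsubseteq>\<^bsub>Mbar M\<^esub> B"
    by (rule Mbar.is_sup_least[OF A]) (auto simp: Mbar_le_iff X B)
  then have "ideal_of M A \<subseteq> (\<Union>n. ideal_of M (X n))" using Ac B by (simp add: Mbar_le_iff)
  moreover have "(\<Union>n. ideal_of M (X n)) \<subseteq> ideal_of M A"
    using Ac X XA by (intro UN_least) (simp add: Mbar_le_iff)
  ultimately show "A \<in> carrier (Mbar M) \<and> ideal_of M A = (\<Union>n. ideal_of M (X n))"
    using Ac by blast
next
  assume "A \<in> carrier (Mbar M) \<and> ideal_of M A = (\<Union>n. ideal_of M (X n))"
  then show "is_sup (Mbar M) X A"
    using assms by (intro Mbar.is_supI) (auto simp: increasing_Mbar_iff Mbar_le_iff)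
qed

lemma ex_sup_Mbar:
  assumes "increasing (Mbar M) X"
  shows "\<exists>A. is_sup (Mbar M) X A"
proof -
  obtain A where "A \<in> carrier (Mbar M)" "ideal_of M A = (\<Union>n. ideal_of M (X n))"
    using assms by (rule ex_ideal_of_Union)
  then show ?thesis using is_sup_Mbar_iff[OF assms] by blast
qed

section \<open>Approximation by images of elements of \<open>M\<close>, and the way-below
  relation\<close>

lemma iota_mono:
  assumes "x \<in> carrier M" "y \<in> carrier M" "x \<sqsubseteq> y"
  shows "iota M x \<sqsubseteq>\<^bsub>Mbar M\<^esub> iota M y"
  using assms way_below_le_trans[of _ x y]
  by (auto simp: Mbar_le_iff iota_closed ideal_of_iota)

lemma increasing_iota: "increasing M X \<Longrightarrow> increasing (Mbar M) (\<lambda>n. iota M (X n))"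
  unfolding increasing_def by (simp add: iota_closed iota_mono)

text \<open>A generating sequence \<open>W\<close> of the ideal works: the ideals of the classes
  \<open>iota M (W n)\<close> exhaust it. This gives density of the image as well as the test
  sequences for \<open>\<lless>\<close> in the quotient.\<close>

lemma ex_iota_sup:
  assumes "A \<in> carrier (Mbar M)"
  obtains W where "rapidly_increasing M W" "\<And>n. W n \<in> ideal_of M A"
    "is_sup (Mbar M) (\<lambda>n. iota M (W n)) A"
proof -
  have R: "rounded_ideal M (ideal_of M A)" using assms by (rule rounded_ideal_ideal_of)
  obtain W where W: "rapidly_increasing M W" "\<And>n. W n \<in> ideal_of M A"
    "\<And>z. z \<in> ideal_of M A \<Longrightarrow> \<exists>n. z \<lless> W n"
    using rounded_ideal_generator[OF R] by blast
  have inc: "increasing M W" using W(1) by (rule rapidly_increasing_imp_increasing)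
  have Wc: "W n \<in> carrier M" for n using inc by (simp add: increasing_def)
  have "z \<in> ideal_of M A" if "z \<lless> W n" for z n
    using rounded_ideal_down[OF R W(2)] that way_below_carrier way_below_imp_le by blast
  then have "ideal_of M A = (\<Union>n. ideal_of M (iota M (W n)))"
    using W(3) by (auto simp: ideal_of_iota Wc)
  then have "is_sup (Mbar M) (\<lambda>n. iota M (W n)) A"
    using is_sup_Mbar_iff[OF increasing_iota[OF inc]] assms by blast
  then show ?thesis using that W by blast
qed

text \<open>Forwards, the relation is tested on the sequence of images with supremum
  \<open>B\<close>, and some \<open>W k\<close> is the bound. Backwards, the single element
  \<open>b\<close> already enters a union of ideals at a finite stage, and downward closure brings
  in all of \<open>ideal_of M A\<close>.\<close>

lemma way_below_Mbar_iff:
  "A \<lless>\<^bsub>Mbar M\<^esub> B \<longleftrightarrow>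
    A \<in> carrier (Mbar M) \<and> B \<in> carrier (Mbar M) \<and>
    (\<exists>b\<in>ideal_of M B. \<forall>a\<in>ideal_of M A. a \<sqsubseteq> b)"
proof
  assume AB: "A \<lless>\<^bsub>Mbar M\<^esub> B"
  then have c: "A \<in> carrier (Mbar M)" "B \<in> carrier (Mbar M)"
    by (simp_all add: Mbar.way_below_carrier)
  obtain W where W: "rapidly_increasing M W" "\<And>n. W n \<in> ideal_of M B"
    "is_sup (Mbar M) (\<lambda>n. iota M (W n)) B"
    using ex_iota_sup[OF c(2)] by blast
  have inc: "increasing M W" using W(1) by (rule rapidly_increasing_imp_increasing)
  obtain k where k: "A \<sqsubseteq>\<^bsub>Mbar M\<^esub> iota M (W k)"
    using AB increasing_iota[OF inc] W(3) Mbar.le_refl[OF c(2)]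
    unfolding way_below_def[of "Mbar M"] by blast
  have "W k \<in> carrier M" using inc by (simp add: increasing_def)
  then have "a \<lless> W k" if "a \<in> ideal_of M A" for a
    using that k c by (auto simp: Mbar_le_iff iota_closed ideal_of_iota)
  then show "A \<in> carrier (Mbar M) \<and> B \<in> carrier (Mbar M) \<and>
      (\<exists>b\<in>ideal_of M B. \<forall>a\<in>ideal_of M A. a \<sqsubseteq> b)"
    using c W(2) way_below_imp_le by blast
next
  assume "A \<in> carrier (Mbar M) \<and> B \<in> carrier (Mbar M) \<and>
      (\<exists>b\<in>ideal_of M B. \<forall>a\<in>ideal_of M A. a \<sqsubseteq> b)"
  then obtain b where c: "A \<in> carrier (Mbar M)" "B \<in> carrier (Mbar M)"
    and b: "b \<in> ideal_of M B" "\<And>a. a \<in> ideal_of M A \<Longrightarrow> a \<sqsubseteq> b"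
    by blast
  show "A \<lless>\<^bsub>Mbar M\<^esub> B"
    unfolding way_below_def[of "Mbar M"]
  proof (intro conjI allI impI)
    fix Y S assume Y: "increasing (Mbar M) Y \<and> is_sup (Mbar M) Y S \<and> B \<sqsubseteq>\<^bsub>Mbar M\<^esub> S"
    then have "S \<in> carrier (Mbar M)" "ideal_of M S = (\<Union>n. ideal_of M (Y n))"
      using is_sup_Mbar_iff by blast+
    then obtain k where k: "b \<in> ideal_of M (Y k)"
      using Y b c by (auto simp: Mbar_le_iff)
    have Yk: "Y k \<in> carrier (Mbar M)" using Y by (simp add: increasing_def)
    have "ideal_of M A \<subseteq> ideal_of M (Y k)"
      using rounded_ideal_down[OF rounded_ideal_ideal_of[OF Yk] k] b
        ideal_of_subset_carrier[OF c(1)] by blast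
    then have "A \<sqsubseteq>\<^bsub>Mbar M\<^esub> Y k" using c Yk by (simp add: Mbar_le_iff)
    then show "\<exists>k. A \<sqsubseteq>\<^bsub>Mbar M\<^esub> Y k" ..
  qed (use c in simp_all)
qed

text \<open>The bounding element is \<open>x\<close> itself: it belongs to the ideal of
  \<open>iota M y\<close> and dominates everything way below it.\<close>

lemma iota_way_below:
  assumes "x \<lless> y"
  shows "iota M x \<lless>\<^bsub>Mbar M\<^esub> iota M y"
  using assms way_below_carrier[OF assms] way_below_imp_le
  by (auto simp: way_below_Mbar_iff iota_closed ideal_of_iota)

section \<open>Compatibility of \<open>\<lless>\<close> and suprema with addition\<close>

lemma way_below_add_Mbar:
  assumes "A \<lless>\<^bsub>Mbar M\<^esub> B" "C \<lless>\<^bsub>Mbar M\<^esub> D"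
  shows "A \<oplus>\<^bsub>Mbar M\<^esub> C \<lless>\<^bsub>Mbar M\<^esub> B \<oplus>\<^bsub>Mbar M\<^esub> D"
proof -
  have c: "A \<in> carrier (Mbar M)" "B \<in> carrier (Mbar M)" "C \<in> carrier (Mbar M)"
    "D \<in> carrier (Mbar M)"
    using assms by (simp_all add: way_below_Mbar_iff)
  note sub = c[THEN ideal_of_subset_carrier]
  \<comment> \<open>The sum \<open>b \<oplus> d\<close> of the two bounds will bound the ideal of
    the sum.\<close>
  obtain b d where bd: "b \<in> ideal_of M B" "\<And>a. a \<in> ideal_of M A \<Longrightarrow> a \<sqsubseteq> b"
    "d \<in> ideal_of M D" "\<And>a. a \<in> ideal_of M C \<Longrightarrow> a \<sqsubseteq> d"
    using assms unfolding way_below_Mbar_iff by blast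
  have bdc: "b \<in> carrier M" "d \<in> carrier M" using bd sub by auto
  have "z \<sqsubseteq> b \<oplus> d" if z: "z \<in> interval_add M (ideal_of M A) (ideal_of M C)" for z
  proof -
    obtain x y where xy: "x \<in> ideal_of M A" "y \<in> ideal_of M C" "z \<sqsubseteq> x \<oplus> y" "z \<in> carrier M"
      using z by (auto simp: interval_add_def)
    then have "x \<in> carrier M" "y \<in> carrier M" using sub by auto
    then show ?thesis
      using le_trans[OF xy(3) add_mono2[of x b y d]] xy bd bdc add_closed by blast
  qed
  moreover have "b \<oplus> d \<in> interval_add M (ideal_of M B) (ideal_of M D)"
    using bd(1,3) sub(2,4) by (rule add_in_interval_add)
  ultimately show ?thesis
    using c by (auto simp: way_below_Mbar_iff Mbar_add_closed ideal_of_add)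
qed

lemma sup_add_Mbar:
  assumes X: "increasing (Mbar M) X" "is_sup (Mbar M) X A"
    and Y: "increasing (Mbar M) Y" "is_sup (Mbar M) Y B"
  shows "is_sup (Mbar M) (\<lambda>n. X n \<oplus>\<^bsub>Mbar M\<^esub> Y n) (A \<oplus>\<^bsub>Mbar M\<^esub> B)"
proof -
  have c: "X n \<in> carrier (Mbar M)" "Y n \<in> carrier (Mbar M)" for n
    using X Y by (simp_all add: increasing_def)
  have A: "A \<in> carrier (Mbar M)" "ideal_of M A = (\<Union>n. ideal_of M (X n))"
    and B: "B \<in> carrier (Mbar M)" "ideal_of M B = (\<Union>n. ideal_of M (Y n))"
    using X Y is_sup_Mbar_iff by blast+
  have inc: "increasing (Mbar M) (\<lambda>n. X n \<oplus>\<^bsub>Mbar M\<^esub> Y n)"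
    using X Y c
    by (simp add: increasing_Mbar_iff Mbar_add_closed ideal_of_add interval_add_subset)
  have mono: "ideal_of M (X m) \<subseteq> ideal_of M (X n)" "ideal_of M (Y m) \<subseteq> ideal_of M (Y n)"
    if "m \<le> n" for m n
    using Mbar.increasing_le[OF X(1) that] Mbar.increasing_le[OF Y(1) that] c
    by (simp_all add: Mbar_le_iff)
  have "interval_add M (ideal_of M A) (ideal_of M B) =
      (\<Union>n. interval_add M (ideal_of M (X n)) (ideal_of M (Y n)))"
  proof (intro equalityI subsetI)
    fix z assume "z \<in> interval_add M (ideal_of M A) (ideal_of M B)"
    then obtain a b i j where z: "z \<in> carrier M" "z \<sqsubseteq> a \<oplus> b" "a \<in> ideal_of M (X i)"
      "b \<in> ideal_of M (Y j)"
      unfolding A(2) B(2) interval_add_def by blast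
    \<comment> \<open>The summands may come from different stages; passing to the later one puts
      both at a common index.\<close>
    then have "a \<in> ideal_of M (X (max i j))" "b \<in> ideal_of M (Y (max i j))"
      using mono(1)[of i "max i j"] mono(2)[of j "max i j"] by auto
    then show "z \<in> (\<Union>n. interval_add M (ideal_of M (X n)) (ideal_of M (Y n)))"
      using z unfolding interval_add_def by blast
  next
    fix z assume "z \<in> (\<Union>n. interval_add M (ideal_of M (X n)) (ideal_of M (Y n)))"
    then show "z \<in> interval_add M (ideal_of M A) (ideal_of M B)"
      unfolding A(2) B(2) interval_add_def by blast
  qed
  then show ?thesis
    using A(1) B(1) c by (simp add: is_sup_Mbar_iff[OF inc] Mbar_add_closed ideal_of_add)
qed

text \<open>For approximation, a rapidly increasing sequence of \<open>M\<close> is pushed forward;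
  it stays rapidly increasing because \<open>iota\<close> preserves \<open>\<lless>\<close>.\<close>

lemma cu_Mbar: "cu (Mbar M)"
proof (intro cu.intro precu.intro precu_axioms.intro cu_axioms.intro)
  show "ordered_monoid (Mbar M)" by (rule ordered_monoid_Mbar)
  show "\<exists>X. rapidly_increasing (Mbar M) X \<and> is_sup (Mbar M) X A"
    if A: "A \<in> carrier (Mbar M)" for A
  proof -
    obtain W where "rapidly_increasing M W" "is_sup (Mbar M) (\<lambda>n. iota M (W n)) A"
      using ex_iota_sup[OF A] by blast
    then show ?thesis
      by (intro exI[of _ "\<lambda>n. iota M (W n)"]) (simp add: rapidly_increasing_def iota_way_below)
  qed
qed (rule way_below_add_Mbar sup_add_Mbar ex_sup_Mbar, assumption+)+

section \<open>The canonical map and the completion\<close>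

lemma order_embedding_iota: "order_embedding M (Mbar M) (iota M)"
  unfolding order_embedding_def monoid_map_def
proof (intro conjI ballI impI)
  show "iota M \<in> hom (omonoid M) (omonoid (Mbar M))"
    by (auto simp: hom_def omonoid_def iota_closed iota_add)
  show "iota M \<zero> = \<zero>\<^bsub>Mbar M\<^esub>" by (simp add: Mbar_zero)
next
  fix x y assume c: "x \<in> carrier M" "y \<in> carrier M" and "iota M x \<sqsubseteq>\<^bsub>Mbar M\<^esub> iota M y"
  then have le: "z \<lless> y" if "z \<lless> x" for z
    using that by (auto simp: Mbar_le_iff iota_closed ideal_of_iota)
  \<comment> \<open>Order reflection: \<open>x\<close> is the supremum of terms way below it, and
    all of these are way below \<open>y\<close>.\<close>
  obtain X where X: "rapidly_increasing M X" "is_sup M X x"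
    using sup_of_rapidly_increasing c by blast
  then have "X n \<lless> y" for n using le rapidly_increasing_way_below_sup by blast
  then show "x \<sqsubseteq> y"
    using is_sup_least[OF X(2) _ c(2)] way_below_imp_le way_below_carrier by blast
qed (rule iota_mono)

text \<open>An element \<open>z \<lless> s\<close> need only satisfy
  \<open>z \<sqsubseteq> X n\<close> at first sight. Interpolating
  \<open>z \<lless> w \<lless> s\<close> and applying the definition to \<open>w\<close> gives
  \<open>z \<lless> X n\<close>, as the union of ideals demands.\<close>

lemma iota_sup:
  assumes X: "increasing M X" "is_sup M X s"
  shows "is_sup (Mbar M) (\<lambda>n. iota M (X n)) (iota M s)"
proof -
  have c: "X n \<in> carrier M" for n using X by (simp add: increasing_def)
  have s: "s \<in> carrier M" "\<And>n. X n \<sqsubseteq> s" using is_supD[OF X(2) c] by blast+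
  have "\<exists>n. z \<lless> X n" if z: "z \<lless> s" for z
  proof -
    \<comment> \<open>Interpolation is read off from roundedness of the ideal of
      \<open>iota M s\<close>, used with both elements equal to \<open>z\<close>.\<close>
    have "rounded_ideal M {z. z \<lless> s}"
      using rounded_ideal_ideal_of[OF iota_closed[OF s(1)]] by (simp add: ideal_of_iota s)
    then obtain w where w: "w \<lless> s" "z \<lless> w"
      using z rounded_ideal_directed[of "{z. z \<lless> s}" z z] by blast
    then obtain n where "w \<sqsubseteq> X n" using X s(1) le_refl unfolding way_below_def by blast
    then show ?thesis using way_below_le_trans w(2) c by blast
  qed
  moreover have "z \<lless> s" if "z \<lless> X n" for z n by (rule way_below_le_trans[OF that s(2,1)])
  ultimately have "ideal_of M (iota M s) = (\<Union>n. ideal_of M (iota M (X n)))"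
    by (auto simp: ideal_of_iota s c)
  then show ?thesis
    by (simp add: is_sup_Mbar_iff[OF increasing_iota[OF X(1)]] iota_closed s(1))
qed

lemma precu_map_iota: "precu_map M (Mbar M) (iota M)"
  using order_embedding_iota iota_sup iota_way_below
  unfolding precu_map_def order_embedding_def by blast

lemma completion_Mbar: "completion M (Mbar M) (iota M)"
proof -
  have "\<exists>W. rapidly_increasing M W \<and> is_sup (Mbar M) (\<lambda>n. iota M (W n)) A"
    if "A \<in> carrier (Mbar M)" for A
    using ex_iota_sup[OF that] by blast
  then show ?thesis
    unfolding completion_def
    using precu_axioms cu_Mbar order_embedding_iota precu_map_iota by blast
qed

end

theorem theorem4p8:
  fixes M :: "('a, 'm) ordered_monoid_scheme"
  assumes "precu M"
  shows "cu (Mbar M) \<and>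
    order_embedding M (Mbar M) (iota M) \<and>
    precu_map M (Mbar M) (iota M) \<and>
    completion M (Mbar M) (iota M)"
  using precu.cu_Mbar[OF assms] precu.order_embedding_iota[OF assms]
    precu.precu_map_iota[OF assms] precu.completion_Mbar[OF assms] by blast

end
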